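(* Consider (possibly complex) square matrices $A$ that are consistently ordered and $2$-cyclic, with splitting $A=D-E-F$, where $D$ is the diagonal of $A$ (nonsingular) and $-E$, $-F$ are the strictly lower and strictly upper triangular parts of $A$, and such that the Jacobi iteration matrix $\mathcal J=D^{-1}(E+F)$ satisfies $\sigma(\mathcal J)\subseteq[-\tilde\mu,\tilde\mu]:=\{t\tilde\mu:t\in[-1,1]\}$ and $\pm\tilde\mu\in\sigma(\mathcal J)$ for some $\tilde\mu\in\mathbb C$ with $\operatorname{Re}(\tilde\mu)\ge 0$. Let $\mathcal L_\omega=(D-\omega E)^{-1}(\omega F+(1-\omega)D)$ be the SOR iteration matrix, let $$\omega_{\rm opt}=\frac{2}{1+\sqrt{1-\tilde\mu^2}}$$ be the optimal relaxation parameter, and let $\delta=|\operatorname{Arg}(\tilde\mu-1)|$. Then $$R_\infty(\mathcal L_{\omega_{\rm opt}})\sim 2\sqrt2\,\sin\left(\frac{\delta}{2}\right)\sqrt{|1-\tilde\mu|}\qquad\text{as }\tilde\mu\to 1,\quad \tilde\mu\in\{z\in\mathbb C:\operatorname{Re}(z)\ge0\}\setminus[1,\infty).$$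
   Context: $\sigma(B)$ is the set of eigenvalues of $B$, $\rho(B)=\max_{\lambda\in\sigma(B)}|\lambda|$ its spectral radius, and $R_\infty(B)=-\log(\rho(B))$ (natural logarithm) the asymptotic convergence rate of the stationary iteration with iteration matrix $B$. $\operatorname{Arg}$ is the principal argument, with values in $(-\pi,\pi]$, and $\sqrt{\cdot}$ is the principal square root (branch cut on the negative real axis). The notation $f\sim g$ means that the ratio $f/g$ tends to $1$. Here the limit is over all matrices $A$ satisfying the assumptions, as $\tilde\mu\to1$ within the stated set: for every $\varepsilon>0$ there is $\eta>0$ such that the ratio of the two sides differs from $1$ by less than $\varepsilon$ whenever $A$ satisfies the assumptions with $\tilde\mu\notin[1,\infty)$ and $|\tilde\mu-1|<\eta$. (The direction of approach, hence $\delta$, is allowed to vary.) An $n\times n$ matrix $A$ is $2$-cyclic if it can be symmetrically permuted (i.e. $PAP^T$ for a permutation matrix $P$) into the block form $\begin{bmatrix} D_1 & A_{12}\\ A_{21} & D_2\end{bmatrix}$ with $D_1,D_2$ diagonal and nonsingular. It is consistently ordered if, with the splitting $A=D-E-F$, the eigenvalues of $\alpha D^{-1}E+\alpha^{-1}D^{-1}F$ are independent of $\alpha\in\mathbb C\setminus\{0\}$. The optimal relaxation parameter is one that minimizes $\rho(\mathcal L_\omega)$ over $\omega\in\mathbb C$. *)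

theory Defs
  imports
    "Jordan_Normal_Form.Spectral_Radius"
    "Jordan_Normal_Form.Gauss_Jordan_Elimination"
    "HOL-Analysis.Complex_Transcendental"
    "HOL-Combinatorics.Permutations"
begin

text \<open>Matrices carry their dimension as data, so a quantifier over \<^typ>\<open>complex mat\<close> ranges over
  matrices of all sizes. Positivity of the size need not be required separately: it follows as
  soon as some number is assumed to lie in the spectrum.\<close>

subsection \<open>The splitting of a matrix and the iteration matrices\<close>

definition D_part :: "complex mat \<Rightarrow> complex mat" where
  "D_part A = mat_diag (dim_row A) (\<lambda>i. A $$ (i, i))"

definition E_part :: "complex mat \<Rightarrow> complex mat" where
  "E_part A = Matrix.mat (dim_row A) (dim_col A) (\<lambda>(i, j). if j < i then - (A $$ (i, j)) else 0)"

definition F_part :: "complex mat \<Rightarrow> complex mat" where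
  "F_part A = Matrix.mat (dim_row A) (dim_col A) (\<lambda>(i, j). if i < j then - (A $$ (i, j)) else 0)"

lemma splitting: "square_mat A \<Longrightarrow> A = D_part A - E_part A - F_part A"
  by (rule eq_matI) (auto simp: D_part_def E_part_def F_part_def mat_diag_def)

text \<open>Only meaningful for invertible matrices; \<^const>\<open>mat_inverse\<close> is \<^const>\<open>None\<close> otherwise.\<close>

definition matinv :: "complex mat \<Rightarrow> complex mat" where
  "matinv B = the (mat_inverse B)"

definition jacobi_mat :: "complex mat \<Rightarrow> complex mat" where
  "jacobi_mat A = matinv (D_part A) * (E_part A + F_part A)"

definition sor_mat :: "complex mat \<Rightarrow> complex \<Rightarrow> complex mat" where
  "sor_mat A \<omega> =
     matinv (D_part A - \<omega> \<cdot>\<^sub>m E_part A) * (\<omega> \<cdot>\<^sub>m F_part A + (1 - \<omega>) \<cdot>\<^sub>m D_part A)"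

subsection \<open>The class of matrices\<close>

definition permutation_matrix :: "nat \<Rightarrow> complex mat \<Rightarrow> bool" where
  "permutation_matrix n P \<longleftrightarrow>
     (\<exists>\<pi>. \<pi> permutes {..<n} \<and> P = Matrix.mat n n (\<lambda>(i, j). if j = \<pi> i then 1 else 0))"

definition two_cyclic :: "complex mat \<Rightarrow> bool" where
  "two_cyclic A \<longleftrightarrow> square_mat A \<and>
     (\<exists>P k m D1 A12 A21 D2.
        permutation_matrix (dim_row A) P \<and>
        D1 \<in> carrier_mat k k \<and> A12 \<in> carrier_mat k m \<and>
        A21 \<in> carrier_mat m k \<and> D2 \<in> carrier_mat m m \<and>
        diagonal_mat D1 \<and> invertible_mat D1 \<and>
        diagonal_mat D2 \<and> invertible_mat D2 \<and>
        P * A * transpose_mat P = four_block_mat D1 A12 A21 D2)"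

definition consistently_ordered :: "complex mat \<Rightarrow> bool" where
  "consistently_ordered A \<longleftrightarrow> square_mat A \<and> invertible_mat (D_part A) \<and>
     (\<forall>\<alpha> \<beta>. \<alpha> \<noteq> 0 \<and> \<beta> \<noteq> 0 \<longrightarrow>
        spectrum (\<alpha> \<cdot>\<^sub>m (matinv (D_part A) * E_part A)
                  + inverse \<alpha> \<cdot>\<^sub>m (matinv (D_part A) * F_part A))
      = spectrum (\<beta> \<cdot>\<^sub>m (matinv (D_part A) * E_part A)
                  + inverse \<beta> \<cdot>\<^sub>m (matinv (D_part A) * F_part A)))"

definition sor_assms :: "complex mat \<Rightarrow> complex \<Rightarrow> bool" where
  "sor_assms A \<mu> \<longleftrightarrow>
     consistently_ordered A \<and> two_cyclic A \<and> Re \<mu> \<ge> 0 \<and>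
     spectrum (jacobi_mat A) \<subseteq> {complex_of_real t * \<mu> | t. t \<in> {-1..1}} \<and>
     \<mu> \<in> spectrum (jacobi_mat A) \<and> - \<mu> \<in> spectrum (jacobi_mat A)"

subsection \<open>Relaxation parameters and convergence rate\<close>

definition optimal_relaxation :: "complex mat \<Rightarrow> complex \<Rightarrow> bool" where
  "optimal_relaxation A \<omega> \<longleftrightarrow>
     (\<forall>w. spectral_radius (sor_mat A \<omega>) \<le> spectral_radius (sor_mat A w))"

definition omega_opt :: "complex \<Rightarrow> complex" where
  "omega_opt \<mu> = 2 / (1 + csqrt (1 - \<mu>\<^sup>2))"

text \<open>A vanishing spectral radius (infinite rate) gets the junk value \<open>- ln 0\<close>.\<close>

definition R_infinity :: "complex mat \<Rightarrow> real" where
  "R_infinity B = - ln (spectral_radius B)"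

end

theory Submission
  imports Defs
begin

text \<open>A nonzero \<open>s\<^sup>2\<close> is an eigenvalue of \<open>\<L>\<^sub>\<omega>\<close> iff \<open>s\<^sup>2 - \<omega> m s + (\<omega> - 1) = 0\<close> for an eigenvalue \<open>m\<close>
  of the Jacobi matrix. For \<open>\<omega> = \<omega>\<^sub>o\<^sub>p\<^sub>t\<close> and \<open>m = t \<mu>\<close> with real \<open>t \<in> [-1, 1]\<close>, all roots have the modulus of
  \<open>\<sigma> = \<mu> / (1 + q)\<close>, where \<open>q = sqrt (1 - \<mu>\<^sup>2)\<close>, so the spectral radius is
  \<open>\<bar>\<sigma>\<bar>\<^sup>2 = \<bar>(1 - q) / (1 + q)\<bar>\<close>. For another \<open>\<omega>\<close>, the roots for \<open>m = \<mu>\<close> satisfy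
  \<open>artanh s\<^sub>1 + artanh s\<^sub>2 = artanh \<mu> = 2 artanh \<sigma>\<close>; since \<open>artanh\<close> maps discs about 0 to convex
  sets, \<open>\<bar>\<sigma>\<bar>\<close> is at most the larger of the moduli of the roots.

  For the asymptotics, the rate equals \<open>artanh u\<close> with \<open>u = 2 Re q / (1 + \<bar>q\<bar>\<^sup>2)\<close>. With
  \<open>a = sqrt (1 - \<mu>)\<close> and \<open>b = sqrt (1 + \<mu>)\<close> one has \<open>q = a b\<close> and \<open>Im (a\<^sup>2 + b\<^sup>2) = 0\<close>, whence
  \<open>Re q = Re a (Re b + (Im a)\<^sup>2 / Re b)\<close>. The factor \<open>Re a = sin (\<delta>/2) sqrt \<bar>1 - \<mu>\<bar>\<close> splits off exactly,
  so the limit is uniform in the direction even where \<open>\<mu>\<close> approaches the cut.\<close>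

subsection \<open>Eigenvalues of the SOR and Jacobi matrices\<close>

lemma invertible_mat_imp_det_nonzero:
  assumes "invertible_mat (B :: complex mat)"
  shows "det B \<noteq> 0"
proof -
  obtain C where sq: "dim_row B = dim_col B"
    and BC: "B * C = 1\<^sub>m (dim_row B)" and CB: "C * B = 1\<^sub>m (dim_row C)"
    using assms unfolding invertible_mat_def inverts_mat_def square_mat.simps by auto
  define n where "n = dim_row B"
  have B: "B \<in> carrier_mat n n" using sq by (auto simp: n_def)
  have "dim_col C = n" using BC n_def by (metis index_mult_mat(3) index_one_mat(3))
  moreover have "dim_row C = n" using CB sq n_def by (metis index_mult_mat(3) index_one_mat(3))
  ultimately have "C \<in> carrier_mat n n" by auto
  hence "det B * det C = det (B * C)" using det_mult[OF B] by simp
  also have "\<dots> = 1" using BC by simp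
  finally show ?thesis by auto
qed

lemma matinv_inverts:
  assumes M: "M \<in> carrier_mat n n" and "det M \<noteq> 0"
  shows "matinv M \<in> carrier_mat n n" "M * matinv M = 1\<^sub>m n"
proof -
  from det_non_zero_imp_unit[OF assms] mat_inverse(1)[OF M]
  obtain B where B: "mat_inverse M = Some B" by (metis not_None_eq)
  from mat_inverse(2)[OF M B] B
  show "matinv M \<in> carrier_mat n n" "M * matinv M = 1\<^sub>m n"
    by (auto simp: matinv_def)
qed

text \<open>Multiplying \<open>X - \<nu> I\<close> by the nonsingular \<open>M\<close> does not
  change whether it is singular. With \<open>X = matinv M * N\<close> this yields determinants free
  of inverses.\<close>

lemma spectrum_iff_det_pencil:
  assumes M: "(M :: complex mat) \<in> carrier_mat n n" and d: "det M \<noteq> 0" and X: "X \<in> carrier_mat n n"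
  shows "\<nu> \<in> spectrum X \<longleftrightarrow> det (M * X - \<nu> \<cdot>\<^sub>m M) = 0"
proof -
  have C: "char_matrix X \<nu> \<in> carrier_mat n n" using X by simp
  have "M * char_matrix X \<nu> = M * X - \<nu> \<cdot>\<^sub>m M"
  proof -
    have "M * char_matrix X \<nu> = M * X + M * ((-\<nu>) \<cdot>\<^sub>m 1\<^sub>m n)"
      unfolding char_matrix_def using M X by (simp add: mult_add_distrib_mat[where nr=n and n=n])
    also have "M * ((-\<nu>) \<cdot>\<^sub>m 1\<^sub>m n) = (-\<nu>) \<cdot>\<^sub>m M"
      using mult_smult_distrib[OF M one_carrier_mat] M by simp
    also have "M * X + (-\<nu>) \<cdot>\<^sub>m M = M * X - \<nu> \<cdot>\<^sub>m M"
      using M X by (intro eq_matI) auto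
    finally show ?thesis .
  qed
  thus ?thesis using det_mult[OF M C] d eigenvalue_det[OF X] by (simp add: spectrum_def)
qed

lemma spectrum_matinv_mult:
  assumes M: "M \<in> carrier_mat n n" and d: "det M \<noteq> 0" and N: "N \<in> carrier_mat n n"
  shows "\<nu> \<in> spectrum (matinv M * N) \<longleftrightarrow> det (N - \<nu> \<cdot>\<^sub>m M) = 0"
proof -
  note I = matinv_inverts[OF M d]
  have "M * (matinv M * N) = N"
    using assoc_mult_mat[OF M I(1) N] I(2) N by simp
  thus ?thesis
    using spectrum_iff_det_pencil[OF M d, of "matinv M * N"] I N by auto
qed

context
  fixes A :: "complex mat" and n :: nat
  assumes ordered: "consistently_ordered A" and n: "n = dim_row A"
begin

lemma carrier_parts [simp]:
  "D_part A \<in> carrier_mat n n" "E_part A \<in> carrier_mat n n" "F_part A \<in> carrier_mat n n"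
  using ordered
  by (auto simp: consistently_ordered_def n D_part_def E_part_def F_part_def mat_diag_def)

lemma dim_parts [simp]:
  "dim_row (D_part A) = n" "dim_row (E_part A) = n" "dim_row (F_part A) = n"
  "dim_col (D_part A) = n" "dim_col (E_part A) = n" "dim_col (F_part A) = n"
  using carrier_parts by (auto simp del: carrier_parts)

lemma det_D_part: "det (D_part A) \<noteq> 0"
  using ordered by (simp add: consistently_ordered_def invertible_mat_imp_det_nonzero)

text \<open>The matrix is lower triangular with the diagonal of \<open>D_part A\<close>, so the
  inverse inside \<open>sor_mat\<close> is genuine for every \<open>\<omega>\<close>.\<close>

lemma det_D_minus_E: "det (D_part A - \<omega> \<cdot>\<^sub>m E_part A) \<noteq> 0"
proof -
  have "det (D_part A - \<omega> \<cdot>\<^sub>m E_part A) = prod_list (diag_mat (D_part A - \<omega> \<cdot>\<^sub>m E_part A))"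
    using ordered
    by (intro det_lower_triangular[where n=n] minus_carrier_mat smult_carrier_mat carrier_parts)
       (auto simp: consistently_ordered_def n D_part_def E_part_def mat_diag_def)
  also have "diag_mat (D_part A - \<omega> \<cdot>\<^sub>m E_part A) = diag_mat (D_part A)"
    using ordered
    by (auto simp: consistently_ordered_def n D_part_def E_part_def mat_diag_def diag_mat_def)
  also have "prod_list \<dots> = det (D_part A)"
    using ordered
    by (intro det_lower_triangular[where n=n, symmetric] carrier_parts)
       (auto simp: consistently_ordered_def n D_part_def E_part_def mat_diag_def)
  finally show ?thesis using det_D_part by simp
qed

lemma sor_mat_carrier: "sor_mat A \<omega> \<in> carrier_mat n n"
  unfolding sor_mat_def
  by (rule mult_carrier_mat[where n=n], rule matinv_inverts(1)[OF _ det_D_minus_E]) auto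

lemma jacobi_mat_carrier: "jacobi_mat A \<in> carrier_mat n n"
  unfolding jacobi_mat_def
  by (rule mult_carrier_mat[where n=n], rule matinv_inverts(1)[OF _ det_D_part]) auto

text \<open>Consistent ordering lets the weight 1 in \<open>jacobi_mat A\<close> be replaced by
  \<open>s\<close>; multiplying by \<open>D_part A\<close> then clears the inverse.\<close>

lemma spectrum_jacobi:
  assumes "s \<noteq> 0"
  shows "m \<in> spectrum (jacobi_mat A) \<longleftrightarrow>
    det (s \<cdot>\<^sub>m E_part A + inverse s \<cdot>\<^sub>m F_part A - m \<cdot>\<^sub>m D_part A) = 0"
proof -
  let ?I = "matinv (D_part A)"
  note I = matinv_inverts[OF carrier_parts(1) det_D_part]
  have dist: "\<alpha> \<cdot>\<^sub>m (?I * E_part A) + inverse \<alpha> \<cdot>\<^sub>m (?I * F_part A)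
      = ?I * (\<alpha> \<cdot>\<^sub>m E_part A + inverse \<alpha> \<cdot>\<^sub>m F_part A)" for \<alpha>
    using I mult_add_distrib_mat[OF I(1), of "\<alpha> \<cdot>\<^sub>m E_part A" n "inverse \<alpha> \<cdot>\<^sub>m F_part A"]
      mult_smult_distrib[OF I(1) carrier_parts(2)] mult_smult_distrib[OF I(1) carrier_parts(3)]
    by simp
  have one: "jacobi_mat A = 1 \<cdot>\<^sub>m (?I * E_part A) + inverse 1 \<cdot>\<^sub>m (?I * F_part A)"
  proof -
    have "1 \<cdot>\<^sub>m E_part A = E_part A" "inverse 1 \<cdot>\<^sub>m F_part A = F_part A"
      by (auto intro!: eq_matI)
    thus ?thesis unfolding dist jacobi_mat_def by simp
  qed
  have "spectrum (jacobi_mat A) = spectrum (s \<cdot>\<^sub>m (?I * E_part A) + inverse s \<cdot>\<^sub>m (?I * F_part A))"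
    unfolding one using ordered assms unfolding consistently_ordered_def
    by (metis zero_neq_one)
  thus ?thesis unfolding dist
    by (simp add: spectrum_matinv_mult[OF carrier_parts(1) det_D_part])
qed

lemma spectrum_sor:
  "\<nu> \<in> spectrum (sor_mat A \<omega>) \<longleftrightarrow> det (\<omega> \<cdot>\<^sub>m F_part A + (1 - \<omega>) \<cdot>\<^sub>m D_part A
     - \<nu> \<cdot>\<^sub>m (D_part A - \<omega> \<cdot>\<^sub>m E_part A)) = 0"
  unfolding sor_mat_def
  by (rule spectrum_matinv_mult[OF _ det_D_minus_E]) auto

text \<open>Young's relation. Consistent ordering enters only here, through \<open>spectrum_jacobi\<close>.\<close>

lemma spectrum_sor_iff_spectrum_jacobi:
  assumes "s \<noteq> 0" "\<omega> \<noteq> 0"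
  shows "s\<^sup>2 \<in> spectrum (sor_mat A \<omega>) \<longleftrightarrow>
    (s\<^sup>2 + \<omega> - 1) / (\<omega> * s) \<in> spectrum (jacobi_mat A)"
proof -
  \<comment> \<open>This \<open>m\<close> matches the coefficients of \<open>D_part A\<close>, so
    that the SOR pencil at \<open>s\<^sup>2\<close> is a scalar multiple of the weighted Jacobi
    pencil.\<close>
  define m where "m = (s\<^sup>2 + \<omega> - 1) / (\<omega> * s)"
  have m: "\<omega> * s * m = s\<^sup>2 + \<omega> - 1" using assms by (simp add: m_def)
  have "\<omega> \<cdot>\<^sub>m F_part A + (1 - \<omega>) \<cdot>\<^sub>m D_part A - s\<^sup>2 \<cdot>\<^sub>m (D_part A - \<omega> \<cdot>\<^sub>m E_part A)
     = (\<omega> * s) \<cdot>\<^sub>m (s \<cdot>\<^sub>m E_part A + inverse s \<cdot>\<^sub>m F_part A - m \<cdot>\<^sub>m D_part A)" (is "?l = ?r")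
  proof (rule eq_matI)
    fix i j assume "i < dim_row ?r" "j < dim_col ?r"
    hence ij: "i < n" "j < n" by auto
    let ?d = "D_part A $$ (i, j)" and ?e = "E_part A $$ (i, j)" and ?f = "F_part A $$ (i, j)"
    have "?r $$ (i, j) = \<omega> * s\<^sup>2 * ?e + \<omega> * (s * inverse s) * ?f - (\<omega> * s * m) * ?d"
      using ij by (simp add: algebra_simps power2_eq_square)
    also have "\<dots> = ?l $$ (i, j)"
      unfolding m using ij assms by (simp add: algebra_simps)
    finally show "?l $$ (i, j) = ?r $$ (i, j)" by simp
  qed auto
  thus ?thesis
    unfolding spectrum_sor spectrum_jacobi[OF assms(1)] m_def[symmetric]
    using assms by simp
qed

text \<open>Covers the parameter that Young's relation excludes: for \<open>\<omega> = 0\<close> the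
  iteration matrix is the identity.\<close>

lemma one_in_spectrum_sor_0:
  assumes "n > 0"
  shows "1 \<in> spectrum (sor_mat A 0)"
proof -
  have "0 \<cdot>\<^sub>m F_part A + (1 - 0) \<cdot>\<^sub>m D_part A - 1 \<cdot>\<^sub>m (D_part A - 0 \<cdot>\<^sub>m E_part A) = 0\<^sub>m n n"
    by (rule eq_matI) auto
  thus ?thesis unfolding spectrum_sor using assms by simp
qed

end

lemma spectrum_pos_dim:
  assumes "\<nu> \<in> spectrum X" "(X :: complex mat) \<in> carrier_mat n n"
  shows "n > 0"
  using assms card_finite_spectrum[OF assms(2)] by (cases n) auto

lemma norm_le_spectral_radius:
  assumes "\<nu> \<in> spectrum X" "X \<in> carrier_mat n n"
  shows "cmod \<nu> \<le> spectral_radius X"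
  using spectral_radius_mem_max(2)[OF assms(2) spectrum_pos_dim[OF assms]] assms(1) by auto

subsection \<open>Discs in the logarithmic Cayley coordinate\<close>

text \<open>With \<open>e = exp (Re z)\<close> and \<open>c = cos (Im z)\<close> the squared moduli
  are \<open>1 + e\<^sup>2 - 2 * e * c\<close> and \<open>1 + e\<^sup>2 + 2 * e * c\<close>;
  squaring and dividing by \<open>2 * e\<close> separates \<open>Re z\<close> from
  \<open>Im z\<close>. For \<open>R < 1\<close> the region is convex inside the strip where
  \<open>Im z\<close> is at most \<open>pi / 2\<close> in modulus.\<close>

lemma cayley_exp_le_iff:
  assumes "0 \<le> R"
  shows "cmod (1 - exp z) \<le> R * cmod (1 + exp z) \<longleftrightarrow>
    (1 - R\<^sup>2) * cosh (Re z) \<le> (1 + R\<^sup>2) * cos (Im z)"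
proof -
  define e c where "e = exp (Re z)" and "c = cos (Im z)"
  have e: "e > 0" by (simp add: e_def)
  have sc: "(sin (Im z))\<^sup>2 = 1 - c\<^sup>2" by (simp add: c_def sin_squared_eq)
  have minus: "(cmod (1 - exp z))\<^sup>2 = 1 + e\<^sup>2 - 2 * e * c"
    by (simp add: cmod_power2 Re_exp Im_exp e_def[symmetric] c_def[symmetric] power_mult_distrib sc)
       (simp add: power2_eq_square algebra_simps)
  have plus: "(cmod (1 + exp z))\<^sup>2 = 1 + e\<^sup>2 + 2 * e * c"
    by (simp add: cmod_power2 Re_exp Im_exp e_def[symmetric] c_def[symmetric] power_mult_distrib sc)
       (simp add: power2_eq_square algebra_simps)
  have ch: "2 * e * cosh (Re z) = 1 + e\<^sup>2"
    using e by (simp add: cosh_def e_def exp_minus field_simps power2_eq_square)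
  have "cmod (1 - exp z) \<le> R * cmod (1 + exp z) \<longleftrightarrow>
      (cmod (1 - exp z))\<^sup>2 \<le> (R * cmod (1 + exp z))\<^sup>2"
    using assms by (simp add: abs_le_square_iff[symmetric] abs_mult)
  also have "\<dots> \<longleftrightarrow> (1 - R\<^sup>2) * (1 + e\<^sup>2) \<le> (1 + R\<^sup>2) * (2 * e * c)"
    unfolding power_mult_distrib minus plus by (simp add: algebra_simps)
  also have "\<dots> \<longleftrightarrow> (2 * e) * ((1 - R\<^sup>2) * cosh (Re z)) \<le> (2 * e) * ((1 + R\<^sup>2) * c)"
    unfolding ch[symmetric] by (simp add: algebra_simps)
  also have "\<dots> \<longleftrightarrow> (1 - R\<^sup>2) * cosh (Re z) \<le> (1 + R\<^sup>2) * c"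
    using e by simp
  finally show ?thesis by (simp add: c_def)
qed

lemma cosh_midpoint_le: "2 * cosh ((a + b) / 2) \<le> cosh a + cosh (b :: real)"
proof -
  have "cosh a + cosh b = 2 * cosh ((a + b) / 2) * cosh ((a - b) / 2)"
    using cosh_add[of "(a + b) / 2" "(a - b) / 2"] cosh_diff[of "(a + b) / 2" "(a - b) / 2"]
    by (simp add: field_simps)
  moreover have "cosh ((a + b) / 2) * 1 \<le> cosh ((a + b) / 2) * cosh ((a - b) / 2)"
    by (intro mult_left_mono cosh_real_ge_1) (simp add: cosh_real_nonneg)
  ultimately show ?thesis by simp
qed

text \<open>The angle bounds make the cosine of the mean nonnegative, so the factor
  \<open>cos ((a - b) / 2)\<close> from the sum formula may be replaced by 1.\<close>

lemma cos_midpoint_ge: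
  assumes "\<bar>a\<bar> \<le> pi / 2" "\<bar>b\<bar> \<le> pi / 2"
  shows "cos a + cos b \<le> 2 * cos ((a + b) / 2)"
proof -
  have "cos ((a + b) / 2) \<ge> 0" using assms by (intro cos_ge_zero) auto
  hence "cos ((a + b) / 2) * cos ((a - b) / 2) \<le> cos ((a + b) / 2) * 1"
    by (intro mult_left_mono) auto
  thus ?thesis by (simp add: cos_plus_cos)
qed

text \<open>In the variable \<open>ln ((1 - s) / (1 + s))\<close> the hypothesis says that \<open>\<mu>\<close> is the sum of \<open>s\<^sub>1\<close>
  and \<open>s\<^sub>2\<close>, while the conclusion concerns their midpoint; the disc of radius \<open>R\<close> is convex in
  this variable.\<close>

lemma cmod_midpoint_le:
  fixes \<mu> s1 s2 :: complex
  assumes sum: "s1 + s2 = \<mu> * (1 + s1 * s2)"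
    and le: "cmod s1 \<le> R" "cmod s2 \<le> R" and "R < 1"
  shows "cmod (\<mu> / (1 + csqrt (1 - \<mu>\<^sup>2))) \<le> R"
proof -
  have R: "0 \<le> R" using le(1) norm_ge_zero order_trans by blast
  have R2: "1 - R\<^sup>2 > 0" using R \<open>R < 1\<close> by (simp add: power_less_one_iff)
  have log: "\<exists>z. exp z = (1 - s) / (1 + s) \<and> \<bar>Im z\<bar> < pi / 2 \<and>
      (1 - R\<^sup>2) * cosh (Re z) \<le> (1 + R\<^sup>2) * cos (Im z)" if s: "cmod s \<le> R" for s
  proof -
    have ne: "1 + s \<noteq> 0" "1 - s \<noteq> 0"
      using s \<open>R < 1\<close> by (auto simp: add_eq_0_iff)
    define z where "z = Ln ((1 - s) / (1 + s))"
    have z: "exp z = (1 - s) / (1 + s)" using ne by (simp add: z_def)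
    have "1 - exp z = 2 * s / (1 + s)" "1 + exp z = 2 / (1 + s)"
      unfolding z using ne by (auto simp: field_simps)
    hence "cmod (1 - exp z) \<le> R * cmod (1 + exp z)"
      using s ne by (simp add: norm_divide norm_mult divide_right_mono)
    hence ineq: "(1 - R\<^sup>2) * cosh (Re z) \<le> (1 + R\<^sup>2) * cos (Im z)"
      using R by (simp add: cayley_exp_le_iff)
    \<comment> \<open>Positivity of the left side forces \<open>cos (Im z) > 0\<close>, which places
      the principal logarithm in the strip where cosine is concave.\<close>
    moreover have "(1 - R\<^sup>2) * cosh (Re z) > 0" using R2 by (simp add: cosh_real_pos)
    ultimately have "(1 + R\<^sup>2) * cos (Im z) > 0" by linarith
    moreover have "1 + R\<^sup>2 > 0" by (simp add: add_pos_nonneg)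
    ultimately have "cos (Im z) > 0" by (rule zero_less_mult_pos)
    hence "Re ((1 - s) / (1 + s)) > 0" by (simp add: z[symmetric] Re_exp)
    hence "\<bar>Im z\<bar> < pi / 2" unfolding z_def using ne by (subst Re_Ln_pos_lt) auto
    thus ?thesis using z ineq by blast
  qed
  obtain z1 where z1: "exp z1 = (1 - s1) / (1 + s1)" "\<bar>Im z1\<bar> < pi / 2"
    "(1 - R\<^sup>2) * cosh (Re z1) \<le> (1 + R\<^sup>2) * cos (Im z1)" using log[OF le(1)] by blast
  obtain z2 where z2: "exp z2 = (1 - s2) / (1 + s2)" "\<bar>Im z2\<bar> < pi / 2"
    "(1 - R\<^sup>2) * cosh (Re z2) \<le> (1 + R\<^sup>2) * cos (Im z2)" using log[OF le(2)] by blast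
  \<comment> \<open>The midpoint of the logarithms makes \<open>w\<close> a square root of the
    product of the two Cayley transforms.\<close>
  define z w where "z = (z1 + z2) / 2" and "w = exp z"
  have Re_z: "Re z = (Re z1 + Re z2) / 2" and Im_z: "Im z = (Im z1 + Im z2) / 2"
    by (simp_all add: z_def)
  have "(1 - R\<^sup>2) * (2 * cosh (Re z)) \<le> (1 - R\<^sup>2) * (cosh (Re z1) + cosh (Re z2))"
    unfolding Re_z using R2 by (intro mult_left_mono cosh_midpoint_le) auto
  also have "\<dots> \<le> (1 + R\<^sup>2) * (cos (Im z1) + cos (Im z2))"
    using z1(3) z2(3) by (simp add: distrib_left)
  also have "\<dots> \<le> (1 + R\<^sup>2) * (2 * cos (Im z))"
    unfolding Im_z using z1(2) z2(2) by (intro mult_left_mono cos_midpoint_ge) auto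
  finally have "cmod (1 - w) \<le> R * cmod (1 + w)"
    using cayley_exp_le_iff[OF R] by (simp add: w_def)
  moreover have "Re w > 0"
    unfolding w_def Re_exp Im_z using z1(2) z2(2) by (intro mult_pos_pos cos_gt_zero_pi) auto
  hence w_ne: "1 + w \<noteq> 0" "w \<noteq> 0" by (auto simp: complex_eq_iff)
  ultimately have s_le: "cmod ((1 - w) / (1 + w)) \<le> R"
    by (simp add: norm_divide divide_le_eq)
  have ne: "1 + s1 \<noteq> 0" "1 + s2 \<noteq> 0"
    using le \<open>R < 1\<close> by (auto simp: add_eq_0_iff)
  have "cmod (s1 * s2) < 1 * 1"
    unfolding norm_mult using le \<open>R < 1\<close> by (intro mult_strict_mono') auto
  hence p: "1 + s1 * s2 \<noteq> 0" by (auto simp: add_eq_0_iff)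
  have "w\<^sup>2 = exp z1 * exp z2"
    by (simp add: w_def z_def exp_add[symmetric] power2_eq_square)
  hence "w\<^sup>2 * ((1 + s1) * (1 + s2)) = (1 - s1) * (1 - s2)"
    unfolding z1(1) z2(1) using ne by simp
  \<comment> \<open>By \<open>sum\<close>, both products contain the factor
    \<open>1 + s1 * s2\<close>; cancelling it gives
    \<open>w\<^sup>2 = (1 - \<mu>) / (1 + \<mu>)\<close> in a form without division.\<close>
  moreover have "(1 + s1) * (1 + s2) = (1 + s1 * s2) * (1 + \<mu>)"
    "(1 - s1) * (1 - s2) = (1 + s1 * s2) * (1 - \<mu>)"
    using sum by (simp_all add: algebra_simps)
  ultimately have "(1 + s1 * s2) * (w\<^sup>2 * (1 + \<mu>)) = (1 + s1 * s2) * (1 - \<mu>)"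
    by (metis mult.left_commute)
  hence "w\<^sup>2 * (1 + \<mu>) = 1 - \<mu>" using p by simp
  moreover have "\<mu> * (1 + w\<^sup>2) - (1 - w\<^sup>2) = w\<^sup>2 * (1 + \<mu>) - (1 - \<mu>)"
    by (simp add: algebra_simps)
  ultimately have \<mu>_w: "\<mu> * (1 + w\<^sup>2) = 1 - w\<^sup>2" by (metis eq_iff_diff_eq_0)
  have w2: "1 + w\<^sup>2 \<noteq> 0"
  proof
    assume "1 + w\<^sup>2 = 0"
    moreover from this have "w\<^sup>2 = - 1" by (rule add_eq_0_iff[THEN iffD1])
    ultimately show False using \<mu>_w by simp
  qed
  have q: "csqrt (1 - \<mu>\<^sup>2) = 2 * w / (1 + w\<^sup>2)"
  proof (rule csqrt_unique)
    have "(1 - \<mu>\<^sup>2) * (1 + w\<^sup>2)\<^sup>2 = (1 + w\<^sup>2)\<^sup>2 - (\<mu> * (1 + w\<^sup>2))\<^sup>2"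
      by (simp only: power_mult_distrib left_diff_distrib mult_1)
    also have "\<dots> = (2 * w)\<^sup>2"
      unfolding \<mu>_w by (simp add: power2_eq_square algebra_simps)
    finally have "(2 * w)\<^sup>2 = (1 - \<mu>\<^sup>2) * (1 + w\<^sup>2)\<^sup>2" by (rule sym)
    thus "(2 * w / (1 + w\<^sup>2))\<^sup>2 = 1 - \<mu>\<^sup>2"
      using w2 by (simp add: power_divide)
    \<comment> \<open>Inversion preserves the right half-plane, so this form shows a positive real
      part and identifies the principal root.\<close>
    have "2 * w / (1 + w\<^sup>2) = 2 * inverse (w + inverse w)"
      using w_ne w2 by (simp add: field_simps power2_eq_square)
    moreover have "Re (w + inverse w) > 0"
      using \<open>Re w > 0\<close> by (simp add: add_pos_nonneg)
    hence "Re (inverse (w + inverse w)) > 0"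
      by (simp only: inverse_complex.sel) (intro divide_pos_pos add_pos_nonneg, auto)
    moreover have "Re (2 * y) = 2 * Re y" for y by simp
    ultimately have "0 < Re (2 * w / (1 + w\<^sup>2))"
      by (metis mult_pos_pos zero_less_numeral)
    thus "0 < Re (2 * w / (1 + w\<^sup>2)) \<or>
        Re (2 * w / (1 + w\<^sup>2)) = 0 \<and> 0 \<le> Im (2 * w / (1 + w\<^sup>2))" ..
  qed
  have "\<mu> = (1 - w\<^sup>2) / (1 + w\<^sup>2)" using \<mu>_w w2 by (metis nonzero_mult_div_cancel_right)
  moreover have "1 + csqrt (1 - \<mu>\<^sup>2) = (1 + w)\<^sup>2 / (1 + w\<^sup>2)"
    unfolding q using w2 by (simp add: field_simps power2_eq_square)
  ultimately have "\<mu> / (1 + csqrt (1 - \<mu>\<^sup>2)) = (1 - w\<^sup>2) / (1 + w)\<^sup>2"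
    using w2 by simp
  also have "1 - w\<^sup>2 = (1 - w) * (1 + w)" by (simp add: power2_eq_square algebra_simps)
  finally have "\<mu> / (1 + csqrt (1 - \<mu>\<^sup>2)) = (1 - w) / (1 + w)"
    using w_ne by (simp add: power2_eq_square)
  thus ?thesis using s_le by simp
qed

section \<open>The double root at the optimal parameter\<close>

text \<open>This is the double root of
  \<open>s\<^sup>2 - \<omega> * \<mu> * s + (\<omega> - 1)\<close> at
  \<open>\<omega> = omega_opt \<mu>\<close>; its product and sum relations are
  \<open>sigma_opt_squared'\<close> and \<open>omega_opt_mult\<close>.\<close>

definition sigma_opt :: "complex \<Rightarrow> complex" where
  "sigma_opt \<mu> = \<mu> / (1 + csqrt (1 - \<mu>\<^sup>2))"

lemma one_plus_csqrt_nonzero: "1 + csqrt z \<noteq> 0"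
proof -
  have "Re (1 + csqrt z) > 0" using Re_csqrt[of z] by (simp del: csqrt.sel)
  thus ?thesis by (metis less_irrefl zero_complex.sel(1))
qed

lemma sigma_opt_squared:
  "(sigma_opt \<mu>)\<^sup>2 = (1 - csqrt (1 - \<mu>\<^sup>2)) / (1 + csqrt (1 - \<mu>\<^sup>2))"
proof -
  define q where "q = csqrt (1 - \<mu>\<^sup>2)"
  have "\<mu>\<^sup>2 = 1 - q\<^sup>2" by (simp add: q_def)
  also have "\<dots> = (1 - q) * (1 + q)" by (simp add: power2_eq_square algebra_simps)
  finally show ?thesis
    unfolding sigma_opt_def q_def[symmetric]
    using one_plus_csqrt_nonzero[of "1 - \<mu>\<^sup>2"]
    by (simp add: power_divide q_def[symmetric] power2_eq_square)
qed

lemma sigma_opt_squared': "(sigma_opt \<mu>)\<^sup>2 = omega_opt \<mu> - 1"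
  unfolding sigma_opt_squared omega_opt_def using one_plus_csqrt_nonzero[of "1 - \<mu>\<^sup>2"]
  by (simp add: field_simps)

lemma omega_opt_mult: "omega_opt \<mu> * \<mu> = 2 * sigma_opt \<mu>"
  by (simp add: omega_opt_def sigma_opt_def)

text \<open>The principal root has nonnegative real part, so it is at least as close to 1 as to -1.
  The bound settles optimality against parameters with spectral radius at least 1.\<close>

lemma cmod_sigma_opt_le_1: "cmod (sigma_opt \<mu>) \<le> 1"
proof -
  define q where "q = csqrt (1 - \<mu>\<^sup>2)"
  have "Re q \<ge> 0" unfolding q_def by (rule Re_csqrt)
  hence "(cmod (1 - q))\<^sup>2 \<le> (cmod (1 + q))\<^sup>2"
    by (simp add: cmod_power2) (simp add: power2_eq_square algebra_simps)
  hence "cmod ((1 - q) / (1 + q)) \<le> 1"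
    by (simp add: norm_divide divide_le_eq)
  hence "(cmod (sigma_opt \<mu>))\<^sup>2 \<le> 1"
    by (simp add: norm_power[symmetric] sigma_opt_squared q_def)
  thus ?thesis by (simp add: power_le_one_iff abs_square_le_1)
qed

subsection \<open>Asymptotics of the rate\<close>

text \<open>The squared moduli of \<open>1 + q\<close> and \<open>1 - q\<close> are
  \<open>N + 2 * Re q\<close> and \<open>N - 2 * Re q\<close> with
  \<open>N = 1 + (cmod q)\<^sup>2\<close>. The hypotheses keep both positive.\<close>

lemma ln_cmod_cayley:
  assumes "0 \<le> Re q" "q \<noteq> 1"
  shows "- ln (cmod ((1 - q) / (1 + q))) = artanh (2 * Re q / (1 + (cmod q)\<^sup>2))"
proof -
  define N x where "N = 1 + (cmod q)\<^sup>2" and "x = Re q"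
  have N: "N > 0" by (simp add: N_def add_pos_nonneg)
  have ne: "1 + q \<noteq> 0" "1 - q \<noteq> 0" using assms by (auto simp: complex_eq_iff)
  have plus: "(cmod (1 + q))\<^sup>2 = N + 2 * x" and minus: "(cmod (1 - q))\<^sup>2 = N - 2 * x"
    unfolding cmod_power2 N_def x_def by (simp_all add: power2_eq_square algebra_simps)
  have pos: "N + 2 * x > 0" "N - 2 * x > 0"
    unfolding plus[symmetric] minus[symmetric] using ne by auto
  have "- ln (cmod ((1 - q) / (1 + q))) = ln (cmod (1 + q)) - ln (cmod (1 - q))"
    using ne by (simp add: norm_divide ln_div)
  also have "\<dots> = (ln (N + 2 * x) - ln (N - 2 * x)) / 2"
    using ne by (simp add: plus[symmetric] minus[symmetric] ln_realpow)
  also have "\<dots> = ln ((N + 2 * x) / (N - 2 * x)) / 2"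
    using pos by (simp add: ln_div)
  also have "(N + 2 * x) / (N - 2 * x) = (1 + 2 * x / N) / (1 - 2 * x / N)"
    using N pos by (simp add: field_simps)
  finally show ?thesis by (simp add: artanh_def N_def x_def)
qed

lemma tendsto_artanh_ratio: "((\<lambda>u :: real. artanh u / u) \<longlongrightarrow> 1) (at 0)"
proof -
  have "(artanh has_field_derivative 1) (at (0 :: real))"
    by (auto intro!: derivative_eq_intros)
  thus ?thesis by (simp add: has_field_derivative_iff)
qed

lemma csqrt_one_minus_square:
  fixes \<mu> :: complex
  defines "a \<equiv> csqrt (1 - \<mu>)" and "b \<equiv> csqrt (1 + \<mu>)"
  assumes "Re \<mu> \<ge> 0" and cut: "\<mu> \<notin> complex_of_real ` {1..}"
  shows "Re a > 0" "Re b > 0" "csqrt (1 - \<mu>\<^sup>2) = a * b"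
    "Re (csqrt (1 - \<mu>\<^sup>2)) = Re a * (Re b + (Im a)\<^sup>2 / Re b)"
proof -
  have a2: "a\<^sup>2 = 1 - \<mu>" and b2: "b\<^sup>2 = 1 + \<mu>" by (simp_all add: a_def b_def)
  show a: "Re a > 0"
  proof (rule ccontr)
    assume "\<not> Re a > 0"
    hence "Re a = 0" using csqrt_principal[of "1 - \<mu>"] by (auto simp: a_def)
    hence "a\<^sup>2 = complex_of_real (- (Im a)\<^sup>2)" by (simp add: complex_eq_iff power2_eq_square)
    hence "\<mu> = complex_of_real (1 + (Im a)\<^sup>2)" using a2 by (simp add: algebra_simps)
    moreover have "1 + (Im a)\<^sup>2 \<in> {1..}" by simp
    ultimately show False using cut by blast
  qed
  have "(Re b)\<^sup>2 - (Im b)\<^sup>2 = 1 + Re \<mu>"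
    using arg_cong[OF b2, of Re] by (simp add: Re_power2)
  hence "Re b \<noteq> 0" using \<open>Re \<mu> \<ge> 0\<close> by (smt (verit) power_zero_numeral zero_le_power2)
  thus b: "Re b > 0" using Re_csqrt[of "1 + \<mu>"] by (simp add: b_def)
  \<comment> \<open>The sum of \<open>a\<^sup>2\<close> and \<open>b\<^sup>2\<close> is the real
    number 2; this eliminates \<open>Im b\<close> and lets \<open>Re a\<close> factor out of
    \<open>Re (a * b)\<close>.\<close>
  have "Re b * Im b = - (Re a * Im a)"
    using arg_cong[OF b2, of Im] arg_cong[OF a2, of Im] by (simp add: Im_power2)
  hence "Im b = - (Re a * Im a) / Re b" using b by (simp add: field_simps)
  hence Re_ab: "Re (a * b) = Re a * (Re b + (Im a)\<^sup>2 / Re b)"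
    by (simp add: algebra_simps power2_eq_square)
  moreover have "\<dots> > 0" using a b by (intro mult_pos_pos add_pos_nonneg) auto
  moreover have "(a * b)\<^sup>2 = 1 - \<mu>\<^sup>2"
    unfolding power_mult_distrib a2 b2 by (simp add: power2_eq_square algebra_simps)
  ultimately show "csqrt (1 - \<mu>\<^sup>2) = a * b" by (intro csqrt_unique) auto
  thus "Re (csqrt (1 - \<mu>\<^sup>2)) = Re a * (Re b + (Im a)\<^sup>2 / Re b)" using Re_ab by simp
qed

text \<open>Half-angle formula: both sides equal \<open>sqrt ((cmod z - Re z) / 2)\<close>.\<close>

lemma Re_csqrt_minus: "Re (csqrt (- z)) = sin (\<bar>Arg z\<bar> / 2) * sqrt (cmod z)"
proof -
  have "sin (\<bar>Arg z\<bar> / 2) \<ge> 0"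
    using Arg_bounded[of z] by (intro sin_ge_zero) auto
  moreover have "(sin (\<bar>Arg z\<bar> / 2))\<^sup>2 = (1 - cos (Arg z)) / 2"
    using cos_double_sin[of "\<bar>Arg z\<bar> / 2"] by simp
  ultimately have "sin (\<bar>Arg z\<bar> / 2) = sqrt ((1 - cos (Arg z)) / 2)"
    by (metis real_sqrt_unique)
  hence "sin (\<bar>Arg z\<bar> / 2) * sqrt (cmod z) = sqrt ((1 - cos (Arg z)) / 2 * cmod z)"
    by (simp only: real_sqrt_mult)
  also have "(1 - cos (Arg z)) / 2 * cmod z = (cmod z - Re z) / 2"
    using rcis_cmod_Arg[of z] by (metis Re_rcis left_diff_distrib mult.commute mult_1 times_divide_eq_left)
  finally show ?thesis by simp
qed

lemma tendsto_rate_ratio: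
  "((\<lambda>\<mu>. - ln (cmod ((1 - csqrt (1 - \<mu>\<^sup>2)) / (1 + csqrt (1 - \<mu>\<^sup>2))))
      / (2 * sqrt 2 * Re (csqrt (1 - \<mu>)))) \<longlongrightarrow> 1)
   (at 1 within {\<mu>. Re \<mu> \<ge> 0} - complex_of_real ` {1..})"
proof -
  define S where "S = {\<mu>. Re \<mu> \<ge> 0} - complex_of_real ` {1..}"
  define a b q where "a = (\<lambda>\<mu>. csqrt (1 - \<mu>))" and "b = (\<lambda>\<mu>. csqrt (1 + \<mu>))"
    and "q = (\<lambda>\<mu>. csqrt (1 - \<mu>\<^sup>2))"
  define u where "u = (\<lambda>\<mu>. 2 * Re (q \<mu>) / (1 + (cmod (q \<mu>))\<^sup>2))"
  let ?F = "at 1 within S"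
  \<comment> \<open>The limit point 0 lies on the branch cut, so the modulus is used, which equals
    \<open>sqrt (cmod (f \<mu>))\<close>.\<close>
  have csqrt_0: "((\<lambda>\<mu>. csqrt (f \<mu>)) \<longlongrightarrow> 0) ?F" if "(f \<longlongrightarrow> 0) ?F" for f
  proof (rule tendsto_norm_zero_cancel)
    have "((\<lambda>\<mu>. sqrt (cmod (f \<mu>))) \<longlongrightarrow> sqrt (cmod 0)) ?F" by (intro tendsto_intros that)
    thus "((\<lambda>\<mu>. cmod (csqrt (f \<mu>))) \<longlongrightarrow> 0) ?F" by simp
  qed
  have a: "(a \<longlongrightarrow> 0) ?F" unfolding a_def by (rule csqrt_0) (auto intro!: tendsto_eq_intros)
  have q: "(q \<longlongrightarrow> 0) ?F" unfolding q_def by (rule csqrt_0) (auto intro!: tendsto_eq_intros)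
  have "isCont csqrt 2" by (rule continuous_at_csqrt) (simp add: complex_nonpos_Reals_iff)
  hence b: "(b \<longlongrightarrow> csqrt 2) ?F" unfolding b_def
    by (rule isCont_tendsto_compose) (auto intro!: tendsto_eq_intros)
  have u: "(u \<longlongrightarrow> 0) ?F" unfolding u_def by (auto intro!: tendsto_eq_intros q)
  have S: "\<forall>\<^sub>F \<mu> in ?F. \<mu> \<in> S" by (auto simp: eventually_at_filter)
  have q_ne_1: "\<forall>\<^sub>F \<mu> in ?F. q \<mu> \<noteq> 1" using tendsto_imp_eventually_ne[OF q] by simp
  have pos: "Re (a \<mu>) > 0" "Re (b \<mu>) > 0"
    "Re (q \<mu>) = Re (a \<mu>) * (Re (b \<mu>) + (Im (a \<mu>))\<^sup>2 / Re (b \<mu>))" if "\<mu> \<in> S" for \<mu>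
    using that csqrt_one_minus_square[of \<mu>] by (auto simp: S_def a_def b_def q_def)
  have u_ne: "u \<mu> \<noteq> 0" if "\<mu> \<in> S" for \<mu>
  proof -
    have "Re (q \<mu>) > 0" unfolding pos(3)[OF that]
      using pos(1,2)[OF that] by (intro mult_pos_pos add_pos_nonneg) auto
    moreover have "1 + (cmod (q \<mu>))\<^sup>2 > 0" by (simp add: add_pos_nonneg)
    ultimately show ?thesis by (simp add: u_def)
  qed
  \<comment> \<open>The limit of \<open>artanh u / u\<close> is over the punctured neighbourhood of
    0, hence the need for \<open>u_ne\<close>.\<close>
  have "filterlim u (at 0) ?F"
    using u S by (auto simp: filterlim_at u_ne elim!: eventually_mono)
  hence lim_artanh: "((\<lambda>\<mu>. artanh (u \<mu>) / u \<mu>) \<longlongrightarrow> 1) ?F"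
    by (rule filterlim_compose[OF tendsto_artanh_ratio])
  \<comment> \<open>Here \<open>Re a\<close> has already cancelled: \<open>b\<close> tends to
    \<open>csqrt 2\<close>, while \<open>a\<close> and \<open>q\<close> vanish.\<close>
  have lim_rest: "((\<lambda>\<mu>. (Re (b \<mu>) + (Im (a \<mu>))\<^sup>2 / Re (b \<mu>)) / sqrt 2 / (1 + (cmod (q \<mu>))\<^sup>2)) \<longlongrightarrow> 1) ?F"
    by (auto intro!: tendsto_eq_intros a b q)
  have lim: "((\<lambda>\<mu>. artanh (u \<mu>) / u \<mu> *
      ((Re (b \<mu>) + (Im (a \<mu>))\<^sup>2 / Re (b \<mu>)) / sqrt 2 / (1 + (cmod (q \<mu>))\<^sup>2))) \<longlongrightarrow> 1) ?F"
    using tendsto_mult[OF lim_artanh lim_rest] by simp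
  have "\<forall>\<^sub>F \<mu> in ?F. artanh (u \<mu>) / u \<mu> *
      ((Re (b \<mu>) + (Im (a \<mu>))\<^sup>2 / Re (b \<mu>)) / sqrt 2 / (1 + (cmod (q \<mu>))\<^sup>2))
    = - ln (cmod ((1 - q \<mu>) / (1 + q \<mu>))) / (2 * sqrt 2 * Re (a \<mu>))"
    using S q_ne_1
  proof eventually_elim
    case (elim \<mu>)
    have "Re (q \<mu>) \<ge> 0" unfolding q_def by (rule Re_csqrt)
    hence "- ln (cmod ((1 - q \<mu>) / (1 + q \<mu>))) = artanh (u \<mu>)"
      unfolding u_def using elim(2) by (rule ln_cmod_cayley)
    moreover have "(Re (b \<mu>) + (Im (a \<mu>))\<^sup>2 / Re (b \<mu>)) / sqrt 2 / (1 + (cmod (q \<mu>))\<^sup>2)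
        = u \<mu> / (2 * sqrt 2 * Re (a \<mu>))"
      unfolding u_def pos(3)[OF elim(1)] using pos(1)[OF elim(1)] by simp
    ultimately show ?case using u_ne[OF elim(1)] by simp
  qed
  hence "((\<lambda>\<mu>. - ln (cmod ((1 - q \<mu>) / (1 + q \<mu>))) / (2 * sqrt 2 * Re (a \<mu>))) \<longlongrightarrow> 1) ?F"
    using lim by (rule Lim_transform_eventually[rotated])
  thus ?thesis by (simp only: S_def a_def q_def)
qed

subsection \<open>The spectral radius of the SOR matrix\<close>

lemma sor_assms_carrier:
  assumes "sor_assms A \<mu>"
  obtains n where "n > 0" "n = dim_row A" "consistently_ordered A"
    "jacobi_mat A \<in> carrier_mat n n" "\<And>\<omega>. sor_mat A \<omega> \<in> carrier_mat n n"
proof -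
  from assms have A: "consistently_ordered A" and \<mu>: "\<mu> \<in> spectrum (jacobi_mat A)"
    by (simp_all add: sor_assms_def)
  show ?thesis
    using that[OF _ refl A jacobi_mat_carrier[OF A refl] sor_mat_carrier[OF A refl]]
      spectrum_pos_dim[OF \<mu> jacobi_mat_carrier[OF A refl]] by blast
qed

lemma spectral_radius_sor_ge:
  assumes A: "sor_assms A \<mu>"
  shows "(cmod (sigma_opt \<mu>))\<^sup>2 \<le> spectral_radius (sor_mat A \<omega>)"
proof -
  define \<rho> where "\<rho> = spectral_radius (sor_mat A \<omega>)"
  from A obtain n where n: "n > 0" "n = dim_row A" and ordered: "consistently_ordered A"
    and carrier: "sor_mat A \<omega> \<in> carrier_mat n n" by (rule sor_assms_carrier) blast
  have \<mu>: "\<mu> \<in> spectrum (jacobi_mat A)" using A by (simp add: sor_assms_def)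
  have le_\<rho>: "cmod \<nu> \<le> \<rho>" if "\<nu> \<in> spectrum (sor_mat A \<omega>)" for \<nu>
    unfolding \<rho>_def using that carrier by (rule norm_le_spectral_radius)
  have \<rho>_nonneg: "\<rho> \<ge> 0"
    using spectral_radius_mem_max(1)[OF carrier n(1)] by (auto simp: \<rho>_def)
  have "(cmod (sigma_opt \<mu>))\<^sup>2 \<le> \<rho>"
  proof (cases "\<rho> < 1")
    case False
    moreover have "(cmod (sigma_opt \<mu>))\<^sup>2 \<le> 1"
      using cmod_sigma_opt_le_1 by (simp add: power_le_one)
    ultimately show ?thesis by linarith
  next
    case True
    \<comment> \<open>At \<open>\<omega> = 0\<close> the eigenvalue 1 would contradict a spectral
      radius below 1.\<close>
    have \<omega>: "\<omega> \<noteq> 0"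
      using le_\<rho>[of 1] one_in_spectrum_sor_0[OF ordered n(2) n(1)] True by auto
    \<comment> \<open>Quadratic formula for
      \<open>s\<^sup>2 - \<omega> * \<mu> * s + (\<omega> - 1) = 0\<close>; either choice of root of
      the discriminant would do.\<close>
    define d where "d = csqrt ((\<omega> * \<mu>)\<^sup>2 - 4 * (\<omega> - 1))"
    define s1 s2 where "s1 = (\<omega> * \<mu> + d) / 2" and "s2 = (\<omega> * \<mu> - d) / 2"
    have sum: "s1 + s2 = \<omega> * \<mu>" by (simp add: s1_def s2_def field_simps)
    have "s1 * s2 = ((\<omega> * \<mu>)\<^sup>2 - d\<^sup>2) / 4"
      by (simp add: s1_def s2_def power2_eq_square algebra_simps)
    also have "(\<omega> * \<mu>)\<^sup>2 - d\<^sup>2 = 4 * (\<omega> - 1)" by (simp add: d_def)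
    also have "4 * (\<omega> - 1) / 4 = \<omega> - 1"
      by (rule nonzero_mult_div_cancel_left) simp
    finally have prod: "s1 * s2 = \<omega> - 1" .
    have le: "cmod s \<le> sqrt \<rho>" if s: "s * (\<omega> * \<mu> - s) = \<omega> - 1" for s
    proof (cases "s = 0")
      case False
      have "s\<^sup>2 + \<omega> - 1 = \<omega> * s * \<mu>"
        using s by (simp add: power2_eq_square algebra_simps)
      hence "s\<^sup>2 \<in> spectrum (sor_mat A \<omega>)"
        using spectrum_sor_iff_spectrum_jacobi[OF ordered n(2) False \<omega>] False \<omega> \<mu> by simp
      from le_\<rho>[OF this] show ?thesis
        by (simp add: norm_power real_le_rsqrt)
    qed (use \<rho>_nonneg in simp)
    have "s2 = \<omega> * \<mu> - s1" "s1 = \<omega> * \<mu> - s2"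
      using sum by (simp_all add: algebra_simps)
    hence "cmod s1 \<le> sqrt \<rho>" "cmod s2 \<le> sqrt \<rho>"
      using prod le[of s1] le[of s2] by (simp_all add: mult.commute)
    \<comment> \<open>Since \<open>\<omega> = 1 + s1 * s2\<close>, the parameter disappears and only
      \<open>\<mu>\<close> remains.\<close>
    moreover have "s1 + s2 = \<mu> * (1 + s1 * s2)"
      unfolding sum prod by simp
    ultimately have "cmod (sigma_opt \<mu>) \<le> sqrt \<rho>"
      unfolding sigma_opt_def using True by (intro cmod_midpoint_le[of s1 s2]) auto
    hence "(cmod (sigma_opt \<mu>))\<^sup>2 \<le> (sqrt \<rho>)\<^sup>2" by (rule power_mono) simp
    thus ?thesis using \<rho>_nonneg by simp
  qed
  thus ?thesis by (simp add: \<rho>_def)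
qed

lemma spectral_radius_sor_omega_opt:
  assumes A: "sor_assms A \<mu>"
  shows "spectral_radius (sor_mat A (omega_opt \<mu>)) = (cmod (sigma_opt \<mu>))\<^sup>2"
proof (rule antisym)
  define \<sigma> \<omega> where "\<sigma> = sigma_opt \<mu>" and "\<omega> = omega_opt \<mu>"
  have \<omega>: "\<omega> \<noteq> 0" unfolding \<omega>_def omega_opt_def using one_plus_csqrt_nonzero by simp
  from A obtain n where n: "n > 0" "n = dim_row A" and ordered: "consistently_ordered A"
    and carrier: "sor_mat A \<omega> \<in> carrier_mat n n" by (rule sor_assms_carrier) blast
  from spectral_radius_mem_max(1)[OF carrier n(1)] obtain \<nu>
    where \<nu>: "\<nu> \<in> spectrum (sor_mat A \<omega>)" "spectral_radius (sor_mat A \<omega>) = cmod \<nu>" by auto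
  have "cmod \<nu> \<le> (cmod \<sigma>)\<^sup>2"
  proof (cases "\<nu> = 0")
    case False
    define s where "s = csqrt \<nu>"
    have s: "s \<noteq> 0" "\<nu> = s\<^sup>2" using False by (simp_all add: s_def)
    have "(s\<^sup>2 + \<omega> - 1) / (\<omega> * s) \<in> spectrum (jacobi_mat A)"
      using \<nu>(1) s spectrum_sor_iff_spectrum_jacobi[OF ordered n(2) s(1) \<omega>] by simp
    then obtain t where t: "t \<in> {-1..1}" "(s\<^sup>2 + \<omega> - 1) / (\<omega> * s) = complex_of_real t * \<mu>"
      using A unfolding sor_assms_def by blast
    have "s\<^sup>2 + (\<omega> - 1) = complex_of_real t * (\<omega> * \<mu>) * s"
      using t(2) s(1) \<omega> by (simp add: field_simps)
    hence eq: "s\<^sup>2 + \<sigma>\<^sup>2 = 2 * complex_of_real t * \<sigma> * s"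
      unfolding \<sigma>_def \<omega>_def sigma_opt_squared'[symmetric] omega_opt_mult by simp
    \<comment> \<open>For real \<open>t\<close> in \<open>[-1, 1]\<close> the roots of
      \<open>x\<^sup>2 - 2 * t * x + 1\<close> are the unit numbers \<open>Complex t r\<close> and
      \<open>Complex t (- r)\<close>; scaling by \<open>\<sigma>\<close> gives the candidates for
      \<open>s\<close>.\<close>
    define r where "r = sqrt (1 - t\<^sup>2)"
    have "t\<^sup>2 \<le> 1" using t(1) by (auto simp: abs_square_le_1)
    hence r: "r\<^sup>2 = 1 - t\<^sup>2" by (simp add: r_def)
    have r': "(complex_of_real r)\<^sup>2 = 1 - (complex_of_real t)\<^sup>2"
      using r by (metis of_real_1 of_real_diff of_real_power)
    have "(s - Complex t r * \<sigma>) * (s - Complex t (- r) * \<sigma>)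
        = s\<^sup>2 + \<sigma>\<^sup>2 - 2 * complex_of_real t * \<sigma> * s
          + ((complex_of_real t)\<^sup>2 + (complex_of_real r)\<^sup>2 - 1) * \<sigma>\<^sup>2"
      by (simp add: Complex_eq power2_eq_square algebra_simps)
    also have "\<dots> = 0" unfolding eq r' by simp
    finally have "s = Complex t r * \<sigma> \<or> s = Complex t (- r) * \<sigma>" by simp
    moreover have "cmod (Complex t r) = 1" "cmod (Complex t (- r)) = 1"
      using r by (simp_all add: complex_norm)
    ultimately have "cmod s = cmod \<sigma>" by (auto simp: norm_mult)
    thus ?thesis by (simp add: s(2) norm_power)
  qed simp
  thus "spectral_radius (sor_mat A (omega_opt \<mu>)) \<le> (cmod (sigma_opt \<mu>))\<^sup>2"
    using \<nu>(2) by (simp add: \<sigma>_def \<omega>_def)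
qed (rule spectral_radius_sor_ge[OF A])

section \<open>Optimality and the uniform limit\<close>

theorem corollary2p2p1:
  shows "(\<forall>A \<mu>. sor_assms A \<mu> \<longrightarrow> optimal_relaxation A (omega_opt \<mu>)) \<and>
    (\<forall>\<epsilon>::real. \<epsilon> > 0 \<longrightarrow>
      (\<exists>\<eta>::real. \<eta> > 0 \<and>
        (\<forall>(A::complex mat) (\<mu>::complex).
           sor_assms A \<mu> \<and> \<mu> \<notin> complex_of_real ` {1..} \<and> cmod (\<mu> - 1) < \<eta> \<longrightarrow>
           (let \<delta> = \<bar>Arg (\<mu> - 1)\<bar> in
             \<bar>R_infinity (sor_mat A (omega_opt \<mu>))
                / (2 * sqrt 2 * sin (\<delta> / 2) * sqrt (cmod (1 - \<mu>))) - 1\<bar> < \<epsilon>))))"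
proof (intro conjI allI impI)
  fix A \<mu> assume "sor_assms A \<mu>"
  thus "optimal_relaxation A (omega_opt \<mu>)"
    by (simp add: optimal_relaxation_def spectral_radius_sor_omega_opt spectral_radius_sor_ge)
next
  fix \<epsilon> :: real assume "\<epsilon> > 0"
  \<comment> \<open>The spectral radius depends on \<open>A\<close> only through
    \<open>\<mu>\<close>, so one \<open>\<eta>\<close> from the scalar limit serves matrices of
    every size.\<close>
  from tendstoD[OF tendsto_rate_ratio this] obtain \<eta> where \<eta>: "\<eta> > 0"
    and lim: "\<And>\<mu>. \<lbrakk>Re \<mu> \<ge> 0; \<mu> \<notin> complex_of_real ` {1..}; \<mu> \<noteq> 1; cmod (\<mu> - 1) < \<eta>\<rbrakk> \<Longrightarrow>
      \<bar>- ln (cmod ((1 - csqrt (1 - \<mu>\<^sup>2)) / (1 + csqrt (1 - \<mu>\<^sup>2))))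
         / (2 * sqrt 2 * Re (csqrt (1 - \<mu>))) - 1\<bar> < \<epsilon>"
    by (auto simp: eventually_at dist_norm)
  show "\<exists>\<eta>>0. \<forall>A \<mu>. sor_assms A \<mu> \<and> \<mu> \<notin> complex_of_real ` {1..} \<and> cmod (\<mu> - 1) < \<eta> \<longrightarrow>
      (let \<delta> = \<bar>Arg (\<mu> - 1)\<bar> in
        \<bar>R_infinity (sor_mat A (omega_opt \<mu>))
           / (2 * sqrt 2 * sin (\<delta> / 2) * sqrt (cmod (1 - \<mu>))) - 1\<bar> < \<epsilon>)"
  proof (intro exI[of _ \<eta>] conjI allI impI \<eta>, elim conjE)
    fix A \<mu> assume A: "sor_assms A \<mu>" and cut: "\<mu> \<notin> complex_of_real ` {1..}"
      and near: "cmod (\<mu> - 1) < \<eta>"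
    have "\<mu> \<noteq> 1" using cut image_eqI[of 1 complex_of_real 1 "{1..}"] by auto
    moreover have "Re \<mu> \<ge> 0" using A by (simp add: sor_assms_def)
    moreover have "R_infinity (sor_mat A (omega_opt \<mu>))
        = - ln (cmod ((1 - csqrt (1 - \<mu>\<^sup>2)) / (1 + csqrt (1 - \<mu>\<^sup>2))))"
      unfolding R_infinity_def spectral_radius_sor_omega_opt[OF A]
      by (simp only: norm_power[symmetric] sigma_opt_squared)
    moreover have "2 * sqrt 2 * sin (\<bar>Arg (\<mu> - 1)\<bar> / 2) * sqrt (cmod (1 - \<mu>))
        = 2 * sqrt 2 * Re (csqrt (1 - \<mu>))"
      using Re_csqrt_minus[of "\<mu> - 1"] by (simp only: minus_diff_eq norm_minus_commute mult.assoc)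
    ultimately show "let \<delta> = \<bar>Arg (\<mu> - 1)\<bar> in
        \<bar>R_infinity (sor_mat A (omega_opt \<mu>))
           / (2 * sqrt 2 * sin (\<delta> / 2) * sqrt (cmod (1 - \<mu>))) - 1\<bar> < \<epsilon>"
      unfolding Let_def using lim[OF _ cut _ near] by metis
  qed
qed

end
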